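(* Let $\varphi$ be a Ma-Minda function with $\varphi(z)=1+B_1z+B_2z^2+\cdots$, and let $f\in\mathcal{S}^*(\varphi)$. If $B_1\le|3B_1^2-B_2|$, then $$|T_{2,1}(f^{-1})|=|b_2^2-b_3^2|\le B_1^2+\frac{(3B_1^2-B_2)^2}{4}.$$ The estimate is sharp (for each such $\varphi$, equality is attained by some $f\in\mathcal{S}^*(\varphi)$).
   Context: $\mathbb{U}=\{z\in\mathbb{C}:|z|<1\}$, and $\mathcal{A}$ is the class of analytic functions $f$ on $\mathbb{U}$ of the form $f(z)=z+\sum_{n\ge2}a_nz^n$. For analytic $g,h$ on $\mathbb{U}$, $g\prec h$ (subordination) means there is an analytic $\omega:\mathbb{U}\to\mathbb{C}$ with $\omega(0)=0$, $|\omega(z)|\le1$, and $g=h\circ\omega$. A Ma-Minda function is an analytic univalent $\varphi$ on $\mathbb{U}$ with $\varphi(0)=1$, $\varphi'(0)>0$, mapping $\mathbb{U}$ onto a domain in the right half-plane that is symmetric about the real axis and starlike with respect to $\varphi(0)=1$ (so $B_1>0$ and all $B_n$ are real). $\mathcal{S}^*(\varphi)=\{f\in\mathcal{A}: zf'(z)/f(z)\prec\varphi(z)\}$; its members are univalent. The local inverse near $0$ is written $f^{-1}(w)=w+\sum_{n\ge2}b_nw^n$; thus $b_2=-a_2$, $b_3=-a_3+2a_2^2$. Definition: $T_{2,1}(f^{-1})=b_2^2-b_3^2$. *)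

theory Defs
  imports "HOL-Complex_Analysis.Complex_Analysis"
begin

abbreviation unit_disc :: "complex set" where
  "unit_disc \<equiv> ball 0 1"

definition class_A :: "(complex \<Rightarrow> complex) set" where
  "class_A = {f. f holomorphic_on unit_disc \<and> f 0 = 0 \<and> deriv f 0 = 1}"

(* By the maximum modulus principle, w 0 = 0 and norm (w z) \<le> 1 force norm (w z) < 1 on the
   disc, so h is only ever evaluated inside the disc. *)
definition subordinate :: "(complex \<Rightarrow> complex) \<Rightarrow> (complex \<Rightarrow> complex) \<Rightarrow> bool"
    (infix "\<prec>\<^sub>s" 50) where
  "g \<prec>\<^sub>s h \<longleftrightarrow> g holomorphic_on unit_disc \<and> h holomorphic_on unit_disc \<and>
     (\<exists>w. w holomorphic_on unit_disc \<and> w 0 = 0 \<and>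
          (\<forall>z\<in>unit_disc. norm (w z) \<le> 1) \<and> (\<forall>z\<in>unit_disc. g z = h (w z)))"

(* No separate "domain" clause: the image of the disc under a nonconstant holomorphic function
   is automatically open and connected. *)
definition ma_minda :: "(complex \<Rightarrow> complex) \<Rightarrow> bool" where
  "ma_minda \<phi> \<longleftrightarrow>
     \<phi> holomorphic_on unit_disc \<and> inj_on \<phi> unit_disc \<and>
     \<phi> 0 = 1 \<and> deriv \<phi> 0 \<in> \<real> \<and> Re (deriv \<phi> 0) > 0 \<and>
     \<phi> ` unit_disc \<subseteq> {w. Re w > 0} \<and>
     cnj ` (\<phi> ` unit_disc) = \<phi> ` unit_disc \<and>
     (\<forall>w\<in>\<phi> ` unit_disc. closed_segment 1 w \<subseteq> \<phi> ` unit_disc)"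

(* z f'(z) / f(z), with its removable singularity at 0 filled in: for f in class A the limit
   there is 1.  At a zero of f other than 0 the quotient has a pole, which the value 0 that
   division by zero returns does not make holomorphic; the holomorphy required by subordination
   therefore excludes such zeros. *)
definition starlike_quotient :: "(complex \<Rightarrow> complex) \<Rightarrow> complex \<Rightarrow> complex" where
  "starlike_quotient f z = (if z = 0 then 1 else z * deriv f z / f z)"

definition starlike_class :: "(complex \<Rightarrow> complex) \<Rightarrow> (complex \<Rightarrow> complex) set" where
  "starlike_class \<phi> = {f \<in> class_A. starlike_quotient f \<prec>\<^sub>s \<phi>}"

(* The Taylor coefficients of a Ma-Minda function are real (ma_minda_coeff_real below), so
   taking real parts loses nothing. *)
definition mm_coeff :: "(complex \<Rightarrow> complex) \<Rightarrow> nat \<Rightarrow> real" where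
  "mm_coeff \<phi> n = Re (fps_nth (fps_expansion \<phi> 0) n)"

definition is_local_inverse :: "(complex \<Rightarrow> complex) \<Rightarrow> (complex \<Rightarrow> complex) \<Rightarrow> bool" where
  "is_local_inverse f g \<longleftrightarrow>
     g analytic_on {0} \<and> g 0 = 0 \<and>
     (\<forall>\<^sub>F z in nhds 0. g (f z) = z) \<and> (\<forall>\<^sub>F w in nhds 0. f (g w) = w)"

(* For f in class A a local inverse exists, and any two agree near 0, so its Taylor
   coefficients do not depend on the choice; see local_inverse_ex and local_inverse_unique. *)
definition local_inverse :: "(complex \<Rightarrow> complex) \<Rightarrow> complex \<Rightarrow> complex" where
  "local_inverse f = (SOME g. is_local_inverse f g)"

definition inv_coeff :: "(complex \<Rightarrow> complex) \<Rightarrow> nat \<Rightarrow> complex" where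
  "inv_coeff f n = fps_nth (fps_expansion (local_inverse f) 0) n"

definition T21_inv :: "(complex \<Rightarrow> complex) \<Rightarrow> complex" where
  "T21_inv f = (inv_coeff f 2)\<^sup>2 - (inv_coeff f 3)\<^sup>2"

lemma local_inverse_ex:
  assumes "f \<in> class_A"
  shows "\<exists>g. is_local_inverse f g"
proof -
  have hol: "f holomorphic_on unit_disc" and f0: "f 0 = 0" and d: "deriv f 0 = 1"
    using assms by (auto simp: class_A_def)
  obtain r where r: "r > 0" "ball 0 r \<subseteq> unit_disc" "inj_on f (ball 0 r)"
    using has_complex_derivative_locally_injective[OF hol, of 0] d by auto
  have holr: "f holomorphic_on ball 0 r"
    using hol r(2) holomorphic_on_subset by blast
  obtain g where g: "g holomorphic_on (f ` ball 0 r)" "\<And>z. z \<in> ball 0 r \<Longrightarrow> g (f z) = z"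
    using holomorphic_has_inverse[OF holr open_ball r(3)] by metis
  have op: "open (f ` ball 0 r)"
    by (rule open_mapping_thm3[OF holr open_ball r(3)])
  have mem: "0 \<in> f ` ball 0 r"
    using f0 r(1) by (metis centre_in_ball imageI)
  have "g analytic_on {0}"
    using g(1) op mem analytic_at by blast
  moreover have "g 0 = 0"
    using g(2)[of 0] f0 r(1) by simp
  moreover have "\<forall>\<^sub>F z in nhds 0. g (f z) = z"
    using g(2) r(1) unfolding eventually_nhds by (metis centre_in_ball open_ball)
  moreover have "\<forall>\<^sub>F w in nhds 0. f (g w) = w"
    unfolding eventually_nhds using op mem g(2) by (metis imageE)
  ultimately show ?thesis
    unfolding is_local_inverse_def by blast
qed

lemma local_inverse_unique:
  assumes "is_local_inverse f g" "is_local_inverse f h"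
  shows "fps_expansion g 0 = fps_expansion h 0"
proof (rule fps_expansion_cong)
  have "isCont h 0" and h0: "h 0 = 0"
    using assms(2) by (auto simp: is_local_inverse_def analytic_at_imp_isCont)
  then have "filterlim h (nhds 0) (nhds 0)"
    by (metis h0 isCont_def tendsto_at_iff_tendsto_nhds)
  then have "\<forall>\<^sub>F w in nhds 0. g (f (h w)) = h w"
    using assms(1) by (auto simp: is_local_inverse_def filterlim_iff)
  moreover have "\<forall>\<^sub>F w in nhds 0. f (h w) = w"
    using assms(2) by (simp add: is_local_inverse_def)
  ultimately show "\<forall>\<^sub>F w in nhds 0. g w = h w"
    by eventually_elim auto
qed

lemma ma_minda_coeff_real:
  assumes "ma_minda \<phi>"
  shows "fps_nth (fps_expansion \<phi> 0) n = complex_of_real (mm_coeff \<phi> n)"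
proof -
  define \<psi> where "\<psi> = cnj \<circ> \<phi> \<circ> cnj"
  have hol: "\<phi> holomorphic_on unit_disc" and inj: "inj_on \<phi> unit_disc" and p0: "\<phi> 0 = 1"
    and d: "deriv \<phi> 0 \<in> \<real>" "Re (deriv \<phi> 0) > 0"
    and sym: "cnj ` (\<phi> ` unit_disc) = \<phi> ` unit_disc"
    using assms by (auto simp: ma_minda_def)
  have sums: "(\<lambda>n. cnj (fps_nth (fps_expansion \<phi> 0) n) * z ^ n) sums \<psi> z"
    if "z \<in> unit_disc" for z
  proof -
    have "(\<lambda>n. fps_nth (fps_expansion \<phi> 0) n * (cnj z - 0) ^ n) sums \<phi> (cnj z)"
      unfolding fps_expansion_def
      using holomorphic_power_series[OF hol, of "cnj z"] that by simp
    then show ?thesis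
      unfolding \<psi>_def by (subst sums_cnj[symmetric]) simp
  qed
  have holpsi: "\<psi> holomorphic_on unit_disc"
    by (rule power_series_holomorphic[where a = "\<lambda>n. cnj (fps_nth (fps_expansion \<phi> 0) n)"])
       (use sums in auto)
  have exp: "fps_expansion \<psi> 0 = Abs_fps (\<lambda>n. cnj (fps_nth (fps_expansion \<phi> 0) n))"
    by (rule fps_expansion_eqI, rule has_fps_expansionI, unfold eventually_nhds,
        rule exI[of _ unit_disc]) (use sums in auto)
  have dpsi: "deriv \<psi> 0 = deriv \<phi> 0"
    using arg_cong[OF exp, of "\<lambda>F. fps_nth F 1"] d(1)
    by (simp add: fps_expansion_def Reals_cnj_iff)
  obtain h where h: "h holomorphic_on (\<phi> ` unit_disc)"
    "\<And>z. z \<in> unit_disc \<Longrightarrow> deriv \<phi> z * deriv h (\<phi> z) = 1"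
    "\<And>z. z \<in> unit_disc \<Longrightarrow> h (\<phi> z) = z"
    using holomorphic_has_inverse[OF hol open_ball inj] by metis
  have op: "open (\<phi> ` unit_disc)"
    by (rule open_mapping_thm3[OF hol open_ball inj])
  have im: "\<psi> z \<in> \<phi> ` unit_disc" if "z \<in> unit_disc" for z
  proof -
    have "cnj z \<in> unit_disc" using that by simp
    then have "\<psi> z \<in> cnj ` (\<phi> ` unit_disc)" unfolding \<psi>_def by auto
    then show ?thesis using sym by simp
  qed
  define k where "k = h \<circ> \<psi>"
  have holk: "k holomorphic_on unit_disc"
    unfolding k_def by (rule holomorphic_on_compose_gen[OF holpsi h(1)]) (use im in blast)
  have psi0: "\<psi> 0 = 1" by (simp add: \<psi>_def p0)
  have k0: "k 0 = 0" using h(3)[of 0] by (simp add: k_def psi0 p0)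
  have kb: "norm (k z) < 1" if z: "norm z < 1" for z
  proof -
    obtain y where y: "y \<in> unit_disc" "\<psi> z = \<phi> y"
      using im[of z] z by auto
    then show ?thesis using h(3)[of y] by (simp add: k_def)
  qed
  have dk: "deriv k 0 = 1"
  proof -
    have "\<psi> field_differentiable at 0"
      using holpsi by (simp add: holomorphic_on_imp_differentiable_at)
    moreover have "h field_differentiable at (\<psi> 0)"
      using h(1) op im[of 0] by (simp add: holomorphic_on_imp_differentiable_at)
    ultimately have "deriv k 0 = deriv h (\<psi> 0) * deriv \<psi> 0"
      unfolding k_def by (rule deriv_chain)
    then show ?thesis using h(2)[of 0] by (simp add: dpsi psi0 p0 mult.commute)
  qed
  have "norm (deriv k 0) = 1" by (simp add: dk)
  then obtain \<alpha> where \<alpha>: "\<And>z. norm z < 1 \<Longrightarrow> k z = \<alpha> * z"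
    using Schwarz_Lemma(3)[OF holk k0 kb, of 0] by auto
  have "\<forall>\<^sub>F z in nhds 0. k z = \<alpha> * z"
    unfolding eventually_nhds by (rule exI[of _ unit_disc]) (use \<alpha> in auto)
  then have "deriv k 0 = deriv (\<lambda>z. \<alpha> * z) 0"
    by (rule deriv_cong_ev) simp
  then have "\<alpha> = 1" using dk by simp
  have eq: "\<psi> z = \<phi> z" if z: "z \<in> unit_disc" for z
  proof -
    obtain y where y: "y \<in> unit_disc" "\<psi> z = \<phi> y"
      using im[OF z] by auto
    then have "y = z" using h(3)[of y] \<alpha>[of z] \<open>\<alpha> = 1\<close> z by (simp add: k_def)
    then show ?thesis using y by simp
  qed
  have "fps_expansion \<psi> 0 = fps_expansion \<phi> 0"
    by (rule fps_expansion_cong, unfold eventually_nhds, rule exI[of _ unit_disc])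
       (use eq in auto)
  then have "cnj (fps_nth (fps_expansion \<phi> 0) n) = fps_nth (fps_expansion \<phi> 0) n"
    using exp by (metis fps_nth_Abs_fps)
  then show ?thesis
    unfolding mm_coeff_def by (metis Reals_cnj_iff of_real_Re)
qed

end

theory Submission
  imports Defs
begin

text \<open>
  Write \<open>z f'(z) / f(z) = \<phi> (w z)\<close> with \<open>w z = c\<^sub>1 z + c\<^sub>2 z^2 + \<dots>\<close>. Comparing coefficients gives
  \<open>b\<^sub>2 = - B\<^sub>1 c\<^sub>1\<close> and \<open>2 b\<^sub>3 = K c\<^sub>1^2 - B\<^sub>1 c\<^sub>2\<close> with \<open>K = 3 B\<^sub>1^2 - B\<^sub>2\<close>. Since
  \<open>\<bar>c\<^sub>2\<bar> \<le> 1 - \<bar>c\<^sub>1\<bar>^2\<close> (Schwarz--Pick for \<open>w z / z\<close>) and \<open>B\<^sub>1 \<le> \<bar>K\<bar>\<close>, we get \<open>\<bar>b\<^sub>3\<bar> \<le> \<bar>K\<bar> / 2\<close>, and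
  the triangle inequality finishes. For \<open>w z = \<i> z\<close> the numbers \<open>b\<^sub>2^2\<close> and \<open>- b\<^sub>3^2\<close> are both
  nonpositive reals of maximal modulus, so equality holds.
\<close>

section \<open>Coefficient bounds for Schwarz functions\<close>

text \<open>By the maximum modulus principle, modulus 1 at an interior point would make
  \<open>w\<close> constant, hence 0. The strict bound keeps \<open>w z\<close> inside the domain of
  \<phi> and gives the Schwarz lemma its hypothesis.\<close>

lemma disc_map_norm_less_1:
  assumes "w holomorphic_on unit_disc" "w 0 = 0"
    and "\<And>z. z \<in> unit_disc \<Longrightarrow> norm (w z) \<le> 1" "z \<in> unit_disc"
  shows "norm (w z) < 1"
proof (rule ccontr)
  assume "\<not> norm (w z) < 1"
  then have nz: "norm (w z) = 1" using assms(3)[OF assms(4)] by simp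
  have "w constant_on unit_disc"
    using maximum_modulus_principle[OF assms(1), of unit_disc z] assms(3,4) nz by auto
  then have "w z = w 0"
    using assms(4) by (auto simp: constant_on_def)
  then show False using nz assms(2) by simp
qed

text \<open>The Schwarz-Pick inequality at the origin: a disc automorphism moves \<open>h 0\<close>
  to 0, and the Schwarz lemma applies to the composite \<open>g\<close>.\<close>

lemma schwarz_pick_deriv_0:
  assumes hol: "h holomorphic_on unit_disc" and lt: "\<And>z. norm z < 1 \<Longrightarrow> norm (h z) < 1"
  shows "norm (deriv h 0) \<le> 1 - (norm (h 0))\<^sup>2"
proof -
  define c where "c = h 0"
  have c: "norm c < 1" using lt[of 0] by (simp add: c_def)
  define g where "g = (\<lambda>z. Moebius_function 0 c (h z))"
  have holg: "g holomorphic_on unit_disc"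
    unfolding g_def
    by (rule holomorphic_on_compose_gen[OF hol Moebius_function_holomorphic[OF c], unfolded o_def])
       (use lt in auto)
  have g0: "g 0 = 0" by (simp add: g_def c_def Moebius_function_eq_zero)
  have "norm (g z) < 1" if "norm z < 1" for z
    unfolding g_def using Moebius_function_norm_lt_1[OF c lt[OF that]] .
  then have dg: "norm (deriv g 0) \<le> 1"
    using Schwarz_Lemma(2)[OF holg g0, of 0] by simp
  have ne: "1 - cnj c * h z \<noteq> 0" if "norm z < 1" for z
  proof
    assume "1 - cnj c * h z = 0"
    then have "norm c * norm (h z) = 1" by (metis complex_mod_cnj eq_iff_diff_eq_0 norm_mult norm_one)
    moreover have "norm c * norm (h z) < 1 * 1"
      by (rule mult_strict_mono') (use c lt[OF that] in auto)
    ultimately show False by simp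
  qed
  \<comment> \<open>With the denominator cleared, the product rule suffices at 0, and the term with
    the derivative of the second factor drops out because \<open>g 0 = 0\<close>.\<close>
  have eq: "g z * (1 - cnj c * h z) = h z - c" if "norm z < 1" for z
    using ne[OF that] by (simp add: g_def Moebius_function_def)
  have h': "(h has_field_derivative deriv h 0) (at 0)"
    using hol by (simp add: holomorphic_derivI)
  have g': "(g has_field_derivative deriv g 0) (at 0)"
    using holg by (simp add: holomorphic_derivI)
  have "((\<lambda>z. g z * (1 - cnj c * h z)) has_field_derivative deriv g 0 * (1 - cnj c * c)) (at 0)"
    by (rule derivative_eq_intros g' h' refl)+ (simp add: g0 c_def)
  moreover have "((\<lambda>z. h z - c) has_field_derivative deriv h 0) (at 0)"
    by (rule derivative_eq_intros h' refl)+ simp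
  moreover have "((\<lambda>z. g z * (1 - cnj c * h z)) has_field_derivative deriv h 0) (at 0) \<longleftrightarrow>
                 ((\<lambda>z. h z - c) has_field_derivative deriv h 0) (at 0)"
    by (rule DERIV_cong_ev) (auto simp: eventually_nhds eq intro!: exI[of _ unit_disc])
  ultimately have "deriv h 0 = deriv g 0 * (1 - cnj c * c)"
    using DERIV_unique by blast
  also have "1 - cnj c * c = of_real (1 - (norm c)\<^sup>2)"
    by (metis complex_norm_square mult.commute of_real_1 of_real_diff of_real_power)
  finally have "norm (deriv h 0) = norm (deriv g 0) * \<bar>1 - (norm c)\<^sup>2\<bar>"
    by (simp only: norm_mult norm_of_real)
  also have "\<bar>1 - (norm c)\<^sup>2\<bar> = 1 - (norm c)\<^sup>2"
    using c by (simp add: abs_square_le_1)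
  also have "norm (deriv g 0) * (1 - (norm c)\<^sup>2) \<le> 1 * (1 - (norm c)\<^sup>2)"
    by (rule mult_right_mono[OF dg]) (use c in \<open>simp add: abs_square_le_1\<close>)
  finally show ?thesis by (simp add: c_def)
qed

text \<open>Writing \<open>w z = z * h z\<close> shifts the coefficients: \<open>h 0\<close> and
  \<open>deriv h 0\<close> are the first and second coefficients of \<open>w\<close>, so the second
  bound is Schwarz-Pick for \<open>h\<close>. That needs \<open>norm (h z) < 1\<close>, which fails
  for rotations; these are treated separately.\<close>

lemma schwarz_function_coeffs:
  assumes hol: "w holomorphic_on unit_disc" and w0: "w 0 = 0"
    and le: "\<And>z. z \<in> unit_disc \<Longrightarrow> norm (w z) \<le> 1"
  defines "W \<equiv> fps_expansion w 0"
  shows "norm (fps_nth W 1) \<le> 1" and "norm (fps_nth W 2) \<le> 1 - (norm (fps_nth W 1))\<^sup>2"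
proof -
  have lt: "norm (w z) < 1" if "norm z < 1" for z
    using disc_map_norm_less_1[OF hol w0 le, of z] that by simp
  obtain h where h: "h holomorphic_on unit_disc" "\<And>z. norm z < 1 \<Longrightarrow> w z = z * h z"
      "deriv w 0 = h 0"
    using Schwarz3[OF hol w0] by blast
  have W1: "fps_nth W 1 = deriv w 0" by (simp add: W_def fps_expansion_def)
  show "norm (fps_nth W 1) \<le> 1"
    unfolding W1 using Schwarz_Lemma(2)[OF hol w0 lt, of 0] by simp
  have h_exp: "h has_fps_expansion fps_expansion h 0"
    by (rule has_fps_expansion_fps_expansion[OF open_ball _ h(1)]) simp
  have "(\<lambda>z. z * h z) has_fps_expansion fps_X * fps_expansion h 0"
    by (intro fps_expansion_intros h_exp)
  moreover have "fps_expansion w 0 = fps_expansion (\<lambda>z. z * h z) 0"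
    by (rule fps_expansion_cong) (auto simp: eventually_nhds h(2) intro!: exI[of _ unit_disc])
  ultimately have "W = fps_X * fps_expansion h 0"
    unfolding W_def using fps_expansion_eqI by metis
  then have W2: "fps_nth W 2 = deriv h 0"
    by (simp add: fps_expansion_def)
  show "norm (fps_nth W 2) \<le> 1 - (norm (fps_nth W 1))\<^sup>2"
  proof (cases "\<exists>z. norm z < 1 \<and> z \<noteq> 0 \<and> norm (w z) = norm z")
    case True
    then obtain \<alpha> where a: "\<And>z. norm z < 1 \<Longrightarrow> w z = \<alpha> * z" "norm \<alpha> = 1"
      using Schwarz_Lemma(3)[OF hol w0 lt, of 0] by auto
    \<comment> \<open>For a rotation the second coefficient is 0 and the first has modulus 1, so the
      bound reads 0 \<le> 0.\<close>
    have "W = fps_const \<alpha> * fps_X"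
      unfolding W_def
      by (rule fps_expansion_eqI, rule has_fps_expansion_cong[THEN iffD2, of _ "\<lambda>z. \<alpha> * z"])
         (auto simp: eventually_nhds a(1) intro!: exI[of _ unit_disc] fps_expansion_intros)
    then show ?thesis using a(2) by simp
  next
    case False
    show ?thesis
    proof (cases "norm (h 0) = 1")
      case True
      then obtain \<alpha> where a: "\<And>z. norm z < 1 \<Longrightarrow> w z = \<alpha> * z" "norm \<alpha> = 1"
        using Schwarz_Lemma(3)[OF hol w0 lt, of 0] h(3) by auto
      \<comment> \<open>Here \<open>w\<close> is again a rotation; any nonzero point of the disc,
        such as 1/2, contradicts the case assumption.\<close>
      have "norm (w (1/2)) = norm (1/2 :: complex)" using a by (simp add: norm_mult norm_divide)
      then show ?thesis using False by (auto dest!: spec[of _ "1/2"] simp: norm_divide)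
    next
      case ne: False
      have "norm (h z) < 1" if z: "norm z < 1" for z
      proof (cases "z = 0")
        case True
        then show ?thesis
          using ne Schwarz_Lemma(2)[OF hol w0 lt, of 0] h(3) by simp
      next
        case nz: False
        have "norm (w z) \<le> norm z" using Schwarz_Lemma(1)[OF hol w0 lt z] .
        then have "norm (w z) < norm z" using False z nz by force
        then show ?thesis using nz h(2)[OF z] by (simp add: norm_mult)
      qed
      then show ?thesis
        using schwarz_pick_deriv_0[OF h(1)] W1 W2 h(3) by simp
    qed
  qed
qed

section \<open>Coefficients of the inverse in terms of \<phi> and the Schwarz function\<close>

text \<open>Near 0 the identity \<open>g (f z) = z\<close> becomes \<open>G oo F = fps_X\<close> for
  the expansions; its first three coefficients determine those of \<open>G\<close> one after the
  other.\<close>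

lemma inv_coeff_2_3:
  assumes "f \<in> class_A"
  defines "F \<equiv> fps_expansion f 0"
  shows "inv_coeff f 2 = - fps_nth F 2"
    and "inv_coeff f 3 = 2 * (fps_nth F 2)\<^sup>2 - fps_nth F 3"
proof -
  define g where "g = local_inverse f"
  define G where "G = fps_expansion g 0"
  have "is_local_inverse f g"
    unfolding g_def local_inverse_def using local_inverse_ex[OF assms(1)] by (rule someI_ex)
  then have g: "g analytic_on {0}" "g 0 = 0" "\<forall>\<^sub>F z in nhds 0. g (f z) = z"
    by (auto simp: is_local_inverse_def)
  have f: "f holomorphic_on unit_disc" "f 0 = 0" "deriv f 0 = 1"
    using assms(1) by (auto simp: class_A_def)
  have F: "f has_fps_expansion F" "fps_nth F 0 = 0" "fps_nth F 1 = 1"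
    using f has_fps_expansion_fps_expansion[OF open_ball _ f(1)]
    by (auto simp: F_def) (auto simp: fps_expansion_def)
  have G: "g has_fps_expansion G" "fps_nth G 0 = 0"
    using g analytic_at_imp_has_fps_expansion_0[OF g(1)]
    by (auto simp: G_def) (auto simp: fps_expansion_def)
  have "(g \<circ> f) has_fps_expansion (G oo F)"
    by (rule has_fps_expansion_compose[OF G(1) F(1,2)])
  moreover have "(g \<circ> f) has_fps_expansion fps_X \<longleftrightarrow> (\<lambda>z::complex. z) has_fps_expansion fps_X"
    by (rule has_fps_expansion_cong) (use g(3) in \<open>auto simp: o_def\<close>)
  ultimately have "G oo F = fps_X"
    using fps_expansion_unique_complex has_fps_expansion_fps_X by blast
  then have eq: "fps_nth (G oo F) n = fps_nth fps_X n" for n by simp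
  note nths = fps_compose_nth fps_mult_nth eval_nat_numeral sum.atLeast0_atMost_Suc
  have "fps_nth G 1 = 1"
    using eq[of 1] F G by (simp add: nths)
  moreover have "fps_nth F 2 + fps_nth G 2 = 0"
    using eq[of 2] F G calculation by (simp add: nths)
  moreover have "fps_nth F 3 + 2 * fps_nth F 2 * fps_nth G 2 + fps_nth G 3 = 0"
    using eq[of 3] F G calculation by (simp add: nths algebra_simps)
  ultimately have "fps_nth G 2 = - fps_nth F 2 \<and>
      fps_nth G 3 = 2 * (fps_nth F 2)\<^sup>2 - fps_nth F 3"
    by algebra
  then show "inv_coeff f 2 = - fps_nth F 2"
    and "inv_coeff f 3 = 2 * (fps_nth F 2)\<^sup>2 - fps_nth F 3"
    by (simp_all only: inv_coeff_def G_def g_def)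
qed

text \<open>Clearing the denominator gives \<open>z * deriv f z = f z * \<phi> (w z)\<close>, whose
  coefficients of degree 2 and 3 determine those of \<open>f\<close>; inversion then gives the
  formulas. An arbitrary Schwarz function \<open>w\<close> is allowed, so both the estimate and the
  extremal function can use them.\<close>

lemma starlike_inv_coeffs:
  assumes mm: "ma_minda \<phi>" and f: "f \<in> class_A"
    and w: "w holomorphic_on unit_disc" "w 0 = 0"
      "\<And>z. z \<in> unit_disc \<Longrightarrow> norm (w z) \<le> 1"
    and q: "\<And>z. z \<in> unit_disc \<Longrightarrow> starlike_quotient f z = \<phi> (w z)"
  defines "B \<equiv> (\<lambda>n. complex_of_real (mm_coeff \<phi> n))" and "W \<equiv> fps_nth (fps_expansion w 0)"
  shows "inv_coeff f 2 = - B 1 * W 1"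
    and "inv_coeff f 3 = ((3 * (B 1)\<^sup>2 - B 2) * (W 1)\<^sup>2 - B 1 * W 2) / 2"
proof -
  define F where "F = fps_expansion f 0"
  define P where "P = fps_expansion \<phi> 0"
  define V where "V = fps_expansion w 0"
  have pos: "Re (\<phi> (w z)) > 0" if "z \<in> unit_disc" for z
    using mm disc_map_norm_less_1[OF w that] by (force simp: ma_minda_def)
  have eq: "z * deriv f z = f z * \<phi> (w z)" if z: "z \<in> unit_disc" for z
  proof (cases "z = 0")
    case True
    then show ?thesis using f by (simp add: class_A_def)
  next
    case False
    then have "z * deriv f z / f z = \<phi> (w z)"
      using q[OF z] by (simp add: starlike_quotient_def)
    \<comment> \<open>At a zero of \<open>f\<close> the quotient would be 0 by the convention for
      division, but \<open>\<phi> (w z)\<close> has positive real part.\<close>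
    moreover from this have "f z \<noteq> 0" using pos[OF z] by auto
    ultimately show ?thesis by (simp add: field_simps)
  qed
  have phi: "\<phi> holomorphic_on unit_disc" "\<phi> 0 = 1" using mm by (auto simp: ma_minda_def)
  have fA: "f holomorphic_on unit_disc" "f 0 = 0" "deriv f 0 = 1"
    using f by (auto simp: class_A_def)
  have exp: "h has_fps_expansion fps_expansion h 0" if "h holomorphic_on unit_disc" for h
    by (rule has_fps_expansion_fps_expansion[OF open_ball _ that]) simp
  have F: "f has_fps_expansion F" "fps_nth F 0 = 0" "fps_nth F 1 = 1"
    using exp fA by (auto simp: F_def fps_expansion_def)
  have V: "w has_fps_expansion V" "fps_nth V 0 = 0"
    using exp w by (auto simp: V_def fps_expansion_def)
  have P: "\<phi> has_fps_expansion P" "fps_nth P 0 = 1"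
    using exp phi by (auto simp: P_def fps_expansion_def)
  have "(\<lambda>z. f z * (\<phi> \<circ> w) z) has_fps_expansion F * (P oo V)"
    by (intro has_fps_expansion_mult has_fps_expansion_compose F V P)
  moreover have "(\<lambda>z. z * deriv f z) has_fps_expansion fps_X * fps_deriv F"
    by (intro has_fps_expansion_mult has_fps_expansion_fps_X has_fps_expansion_deriv F)
  moreover have "(\<lambda>z. z * deriv f z) has_fps_expansion fps_X * fps_deriv F \<longleftrightarrow>
      (\<lambda>z. f z * (\<phi> \<circ> w) z) has_fps_expansion fps_X * fps_deriv F"
    by (rule has_fps_expansion_cong)
       (auto simp: eventually_nhds eq intro!: exI[of _ unit_disc])
  ultimately have "fps_X * fps_deriv F = F * (P oo V)"
    using fps_expansion_unique_complex by blast
  then have eqn: "fps_nth (fps_X * fps_deriv F) n = fps_nth (F * (P oo V)) n" for n by simp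
  note nths = fps_compose_nth fps_mult_nth eval_nat_numeral sum.atLeast0_atMost_Suc
  have e2: "2 * fps_nth F 2 = fps_nth F 2 + fps_nth P 1 * fps_nth V 1"
    using eqn[of 2] F V P by (simp add: nths)
  have e3: "3 * fps_nth F 3 = fps_nth F 3 + fps_nth F 2 * (fps_nth P 1 * fps_nth V 1) +
      (fps_nth P 1 * fps_nth V 2 + fps_nth P 2 * (fps_nth V 1)\<^sup>2)"
    using eqn[of 3] F V P by (simp add: nths algebra_simps)
  have BP: "fps_nth P n = B n" for n
    unfolding P_def B_def using ma_minda_coeff_real[OF mm] .
  have a2: "fps_nth F 2 = B 1 * W 1"
    using e2 unfolding BP W_def V_def by simp
  have a3: "2 * fps_nth F 3 = (B 1 * W 1)\<^sup>2 + B 1 * W 2 + B 2 * (W 1)\<^sup>2"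
    using e3 unfolding BP a2 W_def V_def by algebra
  show "inv_coeff f 2 = - B 1 * W 1"
    using inv_coeff_2_3(1)[OF f] a2 by (simp add: F_def)
  show "inv_coeff f 3 = ((3 * (B 1)\<^sup>2 - B 2) * (W 1)\<^sup>2 - B 1 * W 2) / 2"
  proof -
    \<comment> \<open>The factor 3 is 4 - 1: inversion contributes four times the square of
      \<open>B 1 * W 1\<close>, and twice the third coefficient of \<open>f\<close> takes one
      away.\<close>
    have "2 * inv_coeff f 3 = (3 * (B 1)\<^sup>2 - B 2) * (W 1)\<^sup>2 - B 1 * W 2"
      using inv_coeff_2_3(2)[OF f, folded F_def] a3 unfolding a2 by algebra
    then show ?thesis by (metis nonzero_mult_div_cancel_left zero_neq_numeral)
  qed
qed

section \<open>Existence of functions with a prescribed quotient\<close>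

text \<open>The equation \<open>z * deriv f z / f z = p z\<close> is solved by integrating the
  logarithmic derivative: with \<open>h z = (p z - 1) / z\<close> and a primitive \<open>H\<close>
  of \<open>h\<close>, the solution is \<open>z\<close> times an exponential of
  \<open>H\<close>.\<close>

lemma starlike_quotient_surj:
  assumes "p holomorphic_on unit_disc" "p 0 = 1"
  obtains f where "f \<in> class_A" "\<And>z. z \<in> unit_disc \<Longrightarrow> starlike_quotient f z = p z"
proof -
  have p: "(\<lambda>z. p z - 1) holomorphic_on unit_disc" "p 0 - 1 = 0"
    using assms by (auto intro!: holomorphic_intros)
  obtain h where h: "h holomorphic_on unit_disc" "\<And>z. norm z < 1 \<Longrightarrow> p z - 1 = z * h z"
    using Schwarz3[OF p] by blast
  obtain H where H: "\<And>z. z \<in> unit_disc \<Longrightarrow> (H has_field_derivative h z) (at z)"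
    using holomorphic_convex_primitive'[OF convex_ball open_ball h(1)]
    by (metis at_within_open open_ball)
  \<comment> \<open>Subtracting \<open>H 0\<close> normalises the derivative at 0 to 1. The
    exponential has no zeros, so \<open>f\<close> vanishes only at 0.\<close>
  define f where "f = (\<lambda>z. z * exp (H z - H 0))"
  have df: "(f has_field_derivative (exp (H z - H 0) * (1 + z * h z))) (at z)"
    if "z \<in> unit_disc" for z
    unfolding f_def
    by (rule derivative_eq_intros H[OF that] refl)+ (simp add: algebra_simps)
  have deriv: "deriv f z = exp (H z - H 0) * (1 + z * h z)" if "z \<in> unit_disc" for z
    using DERIV_imp_deriv[OF df[OF that]] .
  show thesis
  proof
    have "f holomorphic_on unit_disc"
      using df unfolding holomorphic_on_open[OF open_ball] by blast
    then show "f \<in> class_A"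
      using deriv[of 0] by (simp add: class_A_def f_def)
    show "starlike_quotient f z = p z" if z: "z \<in> unit_disc" for z
    proof -
      have "p z = 1 + z * h z" using h(2)[of z] z by (simp add: algebra_simps)
      then show ?thesis
        using deriv[OF z] assms(2) by (simp add: starlike_quotient_def f_def)
    qed
  qed
qed

theorem theorem6:
  fixes \<phi> :: "complex \<Rightarrow> complex" and B\<^sub>1 B\<^sub>2 :: real
  assumes "ma_minda \<phi>"
    and "B\<^sub>1 = mm_coeff \<phi> 1" and "B\<^sub>2 = mm_coeff \<phi> 2"
    and "B\<^sub>1 \<le> \<bar>3 * B\<^sub>1\<^sup>2 - B\<^sub>2\<bar>"
  shows "(\<forall>f\<in>starlike_class \<phi>. norm (T21_inv f) \<le> B\<^sub>1\<^sup>2 + (3 * B\<^sub>1\<^sup>2 - B\<^sub>2)\<^sup>2 / 4) \<and>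
         (\<exists>f\<in>starlike_class \<phi>. norm (T21_inv f) = B\<^sub>1\<^sup>2 + (3 * B\<^sub>1\<^sup>2 - B\<^sub>2)\<^sup>2 / 4)"
proof (intro conjI ballI)
  define K where "K = 3 * B\<^sub>1\<^sup>2 - B\<^sub>2"
  have B1: "B\<^sub>1 \<ge> 0"
    using assms(1,2) by (simp add: ma_minda_def mm_coeff_def fps_expansion_def)
  fix f assume "f \<in> starlike_class \<phi>"
  then obtain w where f: "f \<in> class_A" and w: "w holomorphic_on unit_disc" "w 0 = 0"
      "\<And>z. z \<in> unit_disc \<Longrightarrow> norm (w z) \<le> 1"
      "\<And>z. z \<in> unit_disc \<Longrightarrow> starlike_quotient f z = \<phi> (w z)"
    by (auto simp: starlike_class_def subordinate_def)
  define c where "c = fps_nth (fps_expansion w 0)"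
  have c: "norm (c 1) \<le> 1" "norm (c 2) \<le> 1 - (norm (c 1))\<^sup>2"
    unfolding c_def using schwarz_function_coeffs[OF w(1-3)] by auto
  have b2: "inv_coeff f 2 = - of_real B\<^sub>1 * c 1"
    and b3: "inv_coeff f 3 = (of_real K * (c 1)\<^sup>2 - of_real B\<^sub>1 * c 2) / 2"
    using starlike_inv_coeffs[OF assms(1) f w] by (simp_all add: c_def K_def assms(2,3))
  have "norm (inv_coeff f 2) \<le> B\<^sub>1"
    using c(1) B1 by (simp add: b2 norm_mult mult_left_le)
  moreover have "norm (inv_coeff f 3) \<le> \<bar>K\<bar> / 2"
  proof -
    have "norm (inv_coeff f 3) \<le> (\<bar>K\<bar> * (norm (c 1))\<^sup>2 + B\<^sub>1 * norm (c 2)) / 2"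
      unfolding b3 using norm_triangle_ineq4[of "of_real K * (c 1)\<^sup>2" "of_real B\<^sub>1 * c 2"] B1
      by (simp add: norm_divide norm_mult norm_power)
    \<comment> \<open>The hypothesis on the coefficients of \<phi> enters here: with
      \<open>\<bar>K\<bar>\<close> in place of \<open>B\<^sub>1\<close>, the weights
      \<open>(norm (c 1))\<^sup>2\<close> and \<open>1 - (norm (c 1))\<^sup>2\<close> add up to
      1.\<close>
    also have "B\<^sub>1 * norm (c 2) \<le> \<bar>K\<bar> * (1 - (norm (c 1))\<^sup>2)"
      by (rule mult_mono) (use assms(4) c(2) in \<open>auto simp: K_def\<close>)
    finally show ?thesis by (simp add: algebra_simps)
  qed
  ultimately have "(norm (inv_coeff f 2))\<^sup>2 \<le> B\<^sub>1\<^sup>2" "(norm (inv_coeff f 3))\<^sup>2 \<le> (\<bar>K\<bar> / 2)\<^sup>2"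
    by (auto intro!: power_mono)
  moreover have "norm (T21_inv f) \<le> (norm (inv_coeff f 2))\<^sup>2 + (norm (inv_coeff f 3))\<^sup>2"
    unfolding T21_inv_def using norm_triangle_ineq4 by (metis norm_power)
  ultimately show "norm (T21_inv f) \<le> B\<^sub>1\<^sup>2 + (3 * B\<^sub>1\<^sup>2 - B\<^sub>2)\<^sup>2 / 4"
    by (simp add: K_def power_divide)
next
  define K where "K = 3 * B\<^sub>1\<^sup>2 - B\<^sub>2"
  \<comment> \<open>The identity in place of this rotation would give
    \<open>B\<^sub>1\<^sup>2 - K\<^sup>2 / 4\<close>; the factor \<open>\<i>\<close> flips the sign
    of the first square and keeps that of the second.\<close>
  define w where "w = (\<lambda>z. \<i> * z)"
  have phi: "\<phi> holomorphic_on unit_disc" "\<phi> 0 = 1" using assms(1) by (auto simp: ma_minda_def)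
  have w: "w holomorphic_on unit_disc" "w 0 = 0"
      "\<And>z. z \<in> unit_disc \<Longrightarrow> norm (w z) \<le> 1"
    by (auto simp: w_def norm_mult intro!: holomorphic_intros)
  have hol: "(\<lambda>z. \<phi> (w z)) holomorphic_on unit_disc"
    by (rule holomorphic_on_compose_gen[OF w(1) phi(1), unfolded o_def])
       (auto simp: w_def norm_mult)
  obtain f where f: "f \<in> class_A" and q: "\<And>z. z \<in> unit_disc \<Longrightarrow> starlike_quotient f z = \<phi> (w z)"
    using starlike_quotient_surj[OF hol] phi(2) w(2) by auto
  \<comment> \<open>Subordination asks for holomorphy of the quotient itself, which is inherited
    from \<open>\<phi> (w z)\<close> by agreement on the disc.\<close>
  have "starlike_quotient f holomorphic_on unit_disc"
    using holomorphic_transform[OF hol] q by metis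
  then have mem: "f \<in> starlike_class \<phi>"
    using f w q phi(1) unfolding starlike_class_def subordinate_def by blast
  have "fps_expansion w 0 = fps_const \<i> * fps_X"
    unfolding w_def by (rule fps_expansion_eqI) (intro fps_expansion_intros)
  then have "inv_coeff f 2 = - of_real B\<^sub>1 * \<i>" "inv_coeff f 3 = - of_real K / 2"
    using starlike_inv_coeffs[OF assms(1) f w q] by (simp_all add: K_def assms(2,3))
  then have "T21_inv f = - of_real (B\<^sub>1\<^sup>2 + K\<^sup>2 / 4)"
    by (simp add: T21_inv_def power_mult_distrib power_divide)
  then have "norm (T21_inv f) = B\<^sub>1\<^sup>2 + K\<^sup>2 / 4"
    by (simp only: norm_minus_cancel norm_of_real) simp
  with mem show "\<exists>f\<in>starlike_class \<phi>. norm (T21_inv f) = B\<^sub>1\<^sup>2 + (3 * B\<^sub>1\<^sup>2 - B\<^sub>2)\<^sup>2 / 4"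
    by (auto simp: K_def)
qed

end
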